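(* If $n$ is an even positive integer, then the domination number of the discrete torus $T_n$ satisfies $D_n^T\le 4$.
   Context: The discrete $n\times n$ torus is $T_n=\{0,1,\dots,n-1\}\times\{0,1,\dots,n-1\}$, and $\pi_n:\mathbb Z\times\mathbb Z\to T_n$ is $\pi_n(x_1,x_2)=(x_1 \bmod n,\ x_2\bmod n)$, where $a \bmod b$ is the smallest non-negative remainder. A line in $\mathbb Z\times\mathbb Z$ is the intersection with $\mathbb Z\times\mathbb Z$ of a straight line in the plane through at least two integer points. A line on the torus $T_n$ is the image under $\pi_n$ of a line in $\mathbb Z\times\mathbb Z$. A set of points of $T_n$ is collinear if it is contained in a line on the torus. A point $p\in T_n$ is dominated by $S\subseteq T_n$ if $p\in S$ or there exist two distinct points $x,y\in S$ such that $\{x,y,p\}$ is collinear on the torus. $S$ is a dominating set of $T_n$ if every point of $T_n$ is dominated by $S$. The domination number $D_n^T$ is the smallest size of a dominating set of $T_n$. *)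

theory Defs
  imports "HOL-Analysis.Analysis"
begin

definition torus :: "nat \<Rightarrow> (int \<times> int) set" where
  "torus n = {0..<int n} \<times> {0..<int n}"

definition torus_proj :: "nat \<Rightarrow> int \<times> int \<Rightarrow> int \<times> int" where
  "torus_proj n x = (fst x mod int n, snd x mod int n)"

definition real_pt :: "int \<times> int \<Rightarrow> real \<times> real" where
  "real_pt x = (real_of_int (fst x), real_of_int (snd x))"

(* A straight line of the plane is an affine subset of dimension 1; its integer points are
   taken as a subset of int * int, i.e. as the preimage under the embedding real_pt. *)
definition lattice_line :: "(int \<times> int) set \<Rightarrow> bool" where
  "lattice_line l \<longleftrightarrow>
     (\<exists>L :: (real \<times> real) set. affine L \<and> aff_dim L = 1 \<and>
        (\<exists>a b. a \<noteq> b \<and> real_pt a \<in> L \<and> real_pt b \<in> L) \<and>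
        l = real_pt -` L)"

definition torus_line :: "nat \<Rightarrow> (int \<times> int) set \<Rightarrow> bool" where
  "torus_line n M \<longleftrightarrow> (\<exists>l. lattice_line l \<and> M = torus_proj n ` l)"

definition torus_collinear :: "nat \<Rightarrow> (int \<times> int) set \<Rightarrow> bool" where
  "torus_collinear n A \<longleftrightarrow> (\<exists>M. torus_line n M \<and> A \<subseteq> M)"

definition torus_dominated :: "nat \<Rightarrow> (int \<times> int) set \<Rightarrow> int \<times> int \<Rightarrow> bool" where
  "torus_dominated n S p \<longleftrightarrow>
     p \<in> S \<or> (\<exists>x\<in>S. \<exists>y\<in>S. x \<noteq> y \<and> torus_collinear n {x, y, p})"

definition torus_dominating :: "nat \<Rightarrow> (int \<times> int) set \<Rightarrow> bool" where
  "torus_dominating n S \<longleftrightarrow> S \<subseteq> torus n \<and> (\<forall>p\<in>torus n. torus_dominated n S p)"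

(* So the minimum defining the domination number is over a nonempty set. *)
lemma torus_dominating_torus: "torus_dominating n (torus n)"
  by (simp add: torus_dominating_def torus_dominated_def)

definition domination_number :: "nat \<Rightarrow> nat" where
  "domination_number n = (LEAST k. \<exists>S. torus_dominating n S \<and> card S = k)"

end

theory Submission
  imports Defs
begin

text \<open>
  Write \<open>n = 2m\<close> and take \<open>S = {0, m} \<times> {0, m}\<close>. A point \<open>p \<noteq> (0, 0)\<close> is \<open>g\<close> times a primitive
  vector \<open>(u, v)\<close>. The line through the origin with direction \<open>(u, v)\<close> passes through \<open>p\<close> and through
  \<open>(m u, m v)\<close>; since \<open>u\<close> and \<open>v\<close> are not both even, the latter reduces modulo \<open>n\<close> to a point
  of \<open>S\<close> other than the origin.
\<close>

text \<open>The multiple by \<open>k\<close> is the affine combination of the origin and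
  \<open>(u, v)\<close> with weights \<open>1 - k\<close> and \<open>k\<close>, so a single real
  line carries all of them.\<close>

lemma torus_collinear_multiples:
  assumes "(u, v) \<noteq> (0, 0)"
  shows "torus_collinear n (torus_proj n ` (\<lambda>k. (k * u, k * v)) ` K)"
proof -
  define w where "w = real_pt (u, v)"
  define L where "L = affine hull {0, w}"
  have w: "w \<noteq> 0"
    using assms by (auto simp: w_def real_pt_def zero_prod_def)
  have mult: "real_pt (k * u, k * v) \<in> L" for k
  proof -
    have "real_pt (k * u, k * v) = (1 - real_of_int k) *\<^sub>R 0 + real_of_int k *\<^sub>R w"
      by (simp add: w_def real_pt_def)
    then show ?thesis
      unfolding L_def affine_hull_2
      by (intro CollectI exI[of _ "1 - real_of_int k"] exI[of _ "real_of_int k"]) simp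
  qed
  have "real_pt (0, 0) \<in> L" "real_pt (u, v) \<in> L"
    using mult[of 0] mult[of 1] by simp_all
  moreover have "affine L" "aff_dim L = 1"
    using w by (simp_all add: L_def aff_dim_2)
  ultimately have "lattice_line (real_pt -` L)"
    unfolding lattice_line_def using assms by (intro exI[of _ L]) blast
  then show ?thesis
    unfolding torus_collinear_def torus_line_def using mult by blast
qed

text \<open>The factor \<open>m\<close> pulls out of the remainder, leaving
  \<open>m * (u mod 2)\<close>.\<close>

lemma half_period_mult_mod:
  fixes m u :: int
  shows "m * u mod (2 * m) = (if even u then 0 else m)"
  by (simp add: mult.commute[of 2] mod_mult_mult1 mod_2_eq_odd)

lemma torus_dominating_half_periods:
  assumes "m > 0"
  shows "torus_dominating (2 * m) ({0, int m} \<times> {0, int m})"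
  unfolding torus_dominating_def
proof (intro conjI ballI)
  show "{0, int m} \<times> {0, int m} \<subseteq> torus (2 * m)"
    using assms by (auto simp: torus_def)
next
  fix p assume p: "p \<in> torus (2 * m)"
  show "torus_dominated (2 * m) ({0, int m} \<times> {0, int m}) p"
  proof (cases "p = (0, 0)")
    case True
    then show ?thesis by (simp add: torus_dominated_def)
  next
    case False
    obtain a b where ab: "p = (a, b)" by (cases p)
    define g where "g = gcd a b"
    have "g \<noteq> 0" using False ab by (simp add: g_def)
    then obtain u v where uv: "a = u * g" "b = v * g" "coprime u v"
      using gcd_coprime_exists[of a b] unfolding g_def by blast
    have odd: "\<not> (even u \<and> even v)"
      using uv(3) by (meson coprime_common_divisor odd_one)
    define y where "y = torus_proj (2 * m) (int m * u, int m * v)"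
    have y: "y = (if even u then 0 else int m, if even v then 0 else int m)"
      by (simp add: y_def torus_proj_def half_period_mult_mod)
    have "torus_proj (2 * m) (g * u, g * v) = p"
      using p ab uv by (simp add: torus_proj_def torus_def mult.commute)
    moreover have "torus_proj (2 * m) (0 * u, 0 * v) = (0, 0)"
      by (simp add: torus_proj_def)
    \<comment> \<open>The multiples by \<open>0\<close>, \<open>m\<close> and \<open>g\<close>
      project to the three points. Since 0 is even, \<open>odd\<close> also excludes
      \<open>(u, v) = (0, 0)\<close>.\<close>
    ultimately have "torus_collinear (2 * m) {(0, 0), y, p}"
      using torus_collinear_multiples[of u v "2 * m" "{0, int m, g}"] odd
      by (auto simp: y_def)
    moreover have "y \<in> {0, int m} \<times> {0, int m}" "(0, 0) \<noteq> y"
      using assms odd by (auto simp: y)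
    ultimately show ?thesis
      unfolding torus_dominated_def by blast
  qed
qed

theorem corollary3:
  fixes n :: nat
  assumes "n > 0" and "even n"
  shows "domination_number n \<le> 4"
proof -
  obtain m where n: "n = 2 * m" using \<open>even n\<close> by blast
  then have "m > 0" using \<open>n > 0\<close> by simp
  then have "torus_dominating n ({0, int m} \<times> {0, int m})"
    unfolding n by (rule torus_dominating_half_periods)
  \<comment> \<open>The deleted simp rule would expand the product before its cardinality could be
    computed as 2 times 2.\<close>
  moreover have "card ({0, int m} \<times> {0, int m}) = 4"
    using \<open>m > 0\<close> by (simp add: card_cartesian_product del: insert_Times_insert)
  ultimately show ?thesis
    unfolding domination_number_def by (intro Least_le) blast
qed

end
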